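(* For $n\ge 2$ and $n\ne 3$, the biharmonic Green functions for $\mathbb{R}^{n+1}_+$ are $$G^{(0,2)}(X,Y)=\Gamma(X-Y)-\Gamma(\bar X-Y),\qquad G^{(1,3)}(X,Y)=\Gamma(X-Y)+\Gamma(\bar X-Y),$$ $$G^{(0,1)}(X,Y)=\Gamma(X-Y)+\tfrac12\Gamma(|\bar X-Y|)\Big[(n-3)\frac{|X-Y|^2}{|\bar X-Y|^2}-(n-1)\Big],$$ $$G^{(2,3)}(X,Y)=\Gamma(X-Y)-\tfrac12\Gamma(|\bar X-Y|)\Big[(n-3)\frac{|X-Y|^2}{|\bar X-Y|^2}-(n-1)\Big],$$ where $\bar X=(x,-t)$ for $X=(x,t)\in\mathbb{R}^{n+1}_+$. Moreover, there holds $$0\le G^{(0,1)}(X,Y)\le G^{(0,2)}(X,Y)\le G^{(1,3)}(X,Y)\le G^{(2,3)}(X,Y),\qquad \forall\, X,Y\in\overline{\mathbb{R}^{n+1}_+},\ X\neq Y,$$ with equality if and only if either $X\in\mathbb{R}^n$ or $Y\in\mathbb{R}^n$ (here $\mathbb{R}^n$ is identified with $\partial\mathbb{R}^{n+1}_+$).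
   Context: $\mathbb{R}^{n+1}_+=\{X=(x,t):x\in\mathbb{R}^n,\ t>0\}$; $\Delta$, $\overline\Delta$ are the Laplacians on $\mathbb{R}^{n+1}$ and $\mathbb{R}^n$. For $n\ne3$, the fundamental solution of $\Delta^2$ in $\mathbb{R}^{n+1}$ is $\Gamma(X-Y)=\Gamma(|X-Y|)=\frac{1}{2(n-1)(n-3)|\mathbb{S}^n|}|X-Y|^{3-n}$. The conformal boundary operators are $\mathscr{B}^3_0(u)=u$, $\mathscr{B}^3_1(u)=-\partial_tu$, $\mathscr{B}^3_2(u)=\partial_t^2u-\overline\Delta u$, $\mathscr{B}^3_3(u)=\partial_t\Delta u+2\overline\Delta\partial_tu$. The biharmonic Green function for the problem $\Delta^2v=f$ in $\mathbb{R}^{n+1}_+$, $\mathscr{B}^3_i(v)=\mathscr{B}^3_j(v)=0$ on $\partial\mathbb{R}^{n+1}_+$ ($i,j\in\{0,1,2,3\}$, $i<j$, $i+j\neq3$) is a function $G^{(i,j)}(X,Y)=\Gamma(X-Y)+H^{(i,j)}(X,Y)$ on $\overline{\mathbb{R}^{n+1}_+}\times\overline{\mathbb{R}^{n+1}_+}$, where $H^{(i,j)}$ solves $\Delta^2H^{(i,j)}=0$ in $\mathbb{R}^{n+1}_+$, $\mathscr{B}^3_i(H^{(i,j)})=-\mathscr{B}^3_i(\Gamma)$ and $\mathscr{B}^3_j(H^{(i,j)})=-\mathscr{B}^3_j(\Gamma)$ on $\partial\mathbb{R}^{n+1}_+$ (for fixed $X\in\mathbb{R}^{n+1}_+$, the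 operators act in the variable $Y$ on $\Gamma(X-Y)$, with the last coordinate of $Y$ in the role of $t$).
   Formalization: For n=2 the inequality G^(0,2) ≤ G^(1,3) is false (the difference 2Γ(X̄−Y) is negative), so it is claimed only for n ≥ 4; and since G^(0,2)=G^(1,3) never occurs, the equality criterion is stated for the other three inequalities, with G^(0,2) ≠ G^(1,3). *)

theory Defs
  imports "HOL-Analysis.Analysis"
begin

text \<open>Points of $R^{n+1}$ are pairs $(x,t)$ with $x$ in $R^n$, where $n$ is \<^term>\<open>CARD('n)\<close>. The norm of a
  pair is the Euclidean one.\<close>

type_synonym 'n pt = "(real ^ 'n) \<times> real"

definition half_space :: "'n::finite pt set"
  where "half_space = {X. snd X > 0}"

definition closed_half_space :: "'n::finite pt set"
  where "closed_half_space = {X. snd X \<ge> 0}"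

definition half_space_boundary :: "'n::finite pt set"
  where "half_space_boundary = {X. snd X = 0}"

definition reflect :: "'n::finite pt \<Rightarrow> 'n pt"
  where "reflect X = (fst X, - snd X)"

text \<open>Partial derivatives are taken within the closed half-space: they are the usual two-sided ones
  at interior points and for tangential directions; the normal derivative at a boundary point is one-sided.
  This gives the boundary operators their meaning for functions that live on the closed
  half-space only.\<close>

definition partial :: "'n::finite pt \<Rightarrow> ('n pt \<Rightarrow> real) \<Rightarrow> 'n pt \<Rightarrow> real"
  where "partial b u Y =
    vector_derivative (\<lambda>s. u (Y + s *\<^sub>R b)) (at 0 within {s. Y + s *\<^sub>R b \<in> closed_half_space})"

definition partial_t :: "('n::finite pt \<Rightarrow> real) \<Rightarrow> 'n pt \<Rightarrow> real"
  where "partial_t = partial (0, 1)"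

definition laplace :: "('n::finite pt \<Rightarrow> real) \<Rightarrow> 'n pt \<Rightarrow> real"
  where "laplace u Y = (\<Sum>b\<in>Basis. partial b (partial b u) Y)"

definition laplace_tan :: "('n::finite pt \<Rightarrow> real) \<Rightarrow> 'n pt \<Rightarrow> real"
  where "laplace_tan u Y = (\<Sum>e\<in>Basis. partial (e, 0) (partial (e, 0) u) Y)"

text \<open>Class $C^k$ on \<open>S\<close>, meant for \<open>S\<close> the open or the closed half-space; for the latter it is
  regularity up to the boundary.\<close>

primrec Ck_on :: "nat \<Rightarrow> 'n::finite pt set \<Rightarrow> ('n pt \<Rightarrow> real) \<Rightarrow> bool"
  where
    "Ck_on 0 S u \<longleftrightarrow> continuous_on S u"
  | "Ck_on (Suc k) S u \<longleftrightarrow> continuous_on S u \<and>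
       (\<forall>b\<in>Basis.
         (\<forall>Y\<in>S. (\<lambda>s. u (Y + s *\<^sub>R b)) differentiable
                   (at 0 within {s. Y + s *\<^sub>R b \<in> closed_half_space})) \<and>
         Ck_on k S (partial b u))"

definition bdry_op :: "nat \<Rightarrow> ('n::finite pt \<Rightarrow> real) \<Rightarrow> 'n pt \<Rightarrow> real"
  where "bdry_op k u =
    [u,
     \<lambda>Y. - partial_t u Y,
     \<lambda>Y. partial_t (partial_t u) Y - laplace_tan u Y,
     \<lambda>Y. partial_t (laplace u) Y + 2 * laplace_tan (partial_t u) Y] ! k"

text \<open>The area of the unit sphere $S^n$ in $R^{n+1}$, by integration in polar coordinates:
  the unit ball has volume $|S^n|/(n+1)$.\<close>

definition sphere_area :: "nat \<Rightarrow> real"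
  where "sphere_area n = real (n + 1) * unit_ball_vol (real (n + 1))"

definition fund_sol :: "'n::finite pt \<Rightarrow> real"
  where "fund_sol Z = (let n = real CARD('n) in
    1 / (2 * (n - 1) * (n - 3) * sphere_area CARD('n)) * norm Z powr (3 - n))"

text \<open>\<open>H\<close> is a classical solution: $C^4$ in the open half-space and $C^j$ up to the boundary,
  where \<open>j\<close> is the highest order of the two boundary operators. The pair \<open>X = Y\<close> is left out
  of the decomposition because \<^const>\<open>fund_sol\<close> is singular at the origin for $n > 3$.\<close>

definition biharmonic_green :: "nat \<Rightarrow> nat \<Rightarrow> ('n::finite pt \<Rightarrow> 'n pt \<Rightarrow> real) \<Rightarrow> bool"
  where "biharmonic_green i j G \<longleftrightarrow>
    i < j \<and> j \<le> 3 \<and> i + j \<noteq> 3 \<and>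
    (\<exists>H.
      (\<forall>X\<in>closed_half_space. \<forall>Y\<in>closed_half_space. X \<noteq> Y \<longrightarrow>
         G X Y = fund_sol (X - Y) + H X Y) \<and>
      (\<forall>X\<in>half_space.
         Ck_on 4 half_space (H X) \<and>
         Ck_on j closed_half_space (H X) \<and>
         (\<forall>Y\<in>half_space. laplace (laplace (H X)) Y = 0) \<and>
         (\<forall>Y\<in>half_space_boundary.
            bdry_op i (H X) Y = - bdry_op i (\<lambda>Z. fund_sol (X - Z)) Y \<and>
            bdry_op j (H X) Y = - bdry_op j (\<lambda>Z. fund_sol (X - Z)) Y)))"

definition green02 :: "'n::finite pt \<Rightarrow> 'n pt \<Rightarrow> real"
  where "green02 X Y = fund_sol (X - Y) - fund_sol (reflect X - Y)"

definition green13 :: "'n::finite pt \<Rightarrow> 'n pt \<Rightarrow> real"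
  where "green13 X Y = fund_sol (X - Y) + fund_sol (reflect X - Y)"

definition green01 :: "'n::finite pt \<Rightarrow> 'n pt \<Rightarrow> real"
  where "green01 X Y = (let n = real CARD('n) in
    fund_sol (X - Y) + 1/2 * fund_sol (reflect X - Y) *
      ((n - 3) * ((norm (X - Y))\<^sup>2 / (norm (reflect X - Y))\<^sup>2) - (n - 1)))"

definition green23 :: "'n::finite pt \<Rightarrow> 'n pt \<Rightarrow> real"
  where "green23 X Y = (let n = real CARD('n) in
    fund_sol (X - Y) - 1/2 * fund_sol (reflect X - Y) *
      ((n - 3) * ((norm (X - Y))\<^sup>2 / (norm (reflect X - Y))\<^sup>2) - (n - 1)))"

text \<open>For $n = 2$ the fundamental solution is negative off the origin, so the inequality between
  the \<open>(0,2)\<close> and \<open>(1,3)\<close> Green functions, valid for $n > 3$, is reversed.\<close>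

lemma green13_less_green02_dim2:
  fixes X Y :: "'n::finite pt"
  assumes "CARD('n) = 2" "X \<in> closed_half_space" "Y \<in> closed_half_space" "X \<noteq> Y"
  shows "green13 X Y < green02 X Y"
proof -
  have ne: "reflect X - Y \<noteq> 0"
    using assms(2-4) by (auto simp: reflect_def closed_half_space_def prod_eq_iff)
  have "sphere_area 2 > 0"
    unfolding sphere_area_def by (intro mult_pos_pos unit_ball_vol_pos) auto
  then have "fund_sol (reflect X - Y) < 0"
    using ne by (simp add: fund_sol_def assms(1) divide_less_0_iff)
  then show ?thesis
    by (simp add: green02_def green13_def)
qed

end

theory Submission
  imports Defs
begin

text \<open>Writing \<open>r = |reflect X - Y|\<close>, \<open>\<rho> = |X - Y|\<close> and $\Gamma = c\,r^{3-n}$ for the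
  reflected fundamental solution, the identity \<open>\<rho>\<^sup>2 = r\<^sup>2 - 4ts\<close> (\<open>t\<close>, \<open>s\<close> the
  last coordinates of \<open>X\<close>, \<open>Y\<close>) turns the regular parts of the four Green functions into
  $\mp\Gamma$ and $\mp(\Gamma + 2(n-3)c\,t\,s\,r^{1-n})$. Here $r^{3-n}$ is biharmonic, and
  $s\,r^{1-n}$ is biharmonic because $r^{1-n}$ is harmonic. On the boundary, operators of even order in
  the normal variable do not see the reflection, those of odd order change sign, and the
  term $s\,r^{1-n}$ makes up the difference.

  With $q = \rho^2/r^2 \in (0,1]$ and $a = (n-3)/2$, the inequalities reduce to
  $a\,(q^{-a} + aq - a - 1) \ge 0$ and $a^2(1-q) \ge 0$, where equality means $q = 1$,
  i.e. \<open>ts = 0\<close>; the constant \<open>c\<close> has the sign of \<open>a\<close>.\<close>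

subsection \<open>Calculus on relatively open subsets of the closed half-space\<close>

text \<open>Relational companion of \<open>partial\<close>: it asserts existence together with the
  value, so the \<open>DERIV\<close> rules apply directly. The filter is that of
  \<open>partial\<close>, hence one-sided for the normal direction at boundary points.\<close>

definition has_partial :: "'n::finite pt \<Rightarrow> ('n pt \<Rightarrow> real) \<Rightarrow> 'n pt \<Rightarrow> real \<Rightarrow> bool"
  where "has_partial b u Y d \<longleftrightarrow>
    ((\<lambda>s. u (Y + s *\<^sub>R b)) has_real_derivative d) (at 0 within {s. Y + s *\<^sub>R b \<in> closed_half_space})"

text \<open>Relative openness keeps boundary points in the domain while derivatives remain local.
  The instances that matter are the closed half-space and the closed half-space without a
  pole.\<close>

definition rel_open :: "'n::finite pt set \<Rightarrow> bool"
  where "rel_open S \<longleftrightarrow> openin (top_of_set closed_half_space) S"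

lemma rel_openD: "rel_open S \<Longrightarrow> Y \<in> S \<Longrightarrow> Y \<in> closed_half_space"
  unfolding rel_open_def using openin_imp_subset by blast

lemma rel_open_closed_half_space: "rel_open closed_half_space"
  by (simp add: rel_open_def)

lemma rel_open_punctured: "rel_open (closed_half_space - {Z})"
  unfolding rel_open_def by (simp add: openin_delete)

lemma Basis_pt: "(Basis :: 'n::finite pt set) = (\<lambda>e. (e, 0)) ` Basis \<union> {(0, 1)}"
  by (auto simp: Basis_prod_def)

text \<open>\<open>Basis\<close> contains \<open>(0, 1)\<close> but not its negative, so all
  nonnegative parameters stay in the closed half-space. Derivatives are therefore unique even at
  boundary points.\<close>

lemma line_within_nontrivial:
  fixes Y :: "'n::finite pt"
  assumes "Y \<in> closed_half_space" "b \<in> Basis"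
  shows "at 0 within {s. Y + s *\<^sub>R b \<in> closed_half_space} \<noteq> bot"
proof -
  have "{0::real..} \<subseteq> {s. Y + s *\<^sub>R b \<in> closed_half_space}"
    using assms by (auto simp: closed_half_space_def Basis_pt)
  moreover have "at (0::real) within {0..} \<noteq> bot"
    by (simp add: at_within_Ici_at_right)
  ultimately show ?thesis
    using at_le le_bot by metis
qed

lemma has_partial_imp_partial:
  assumes "has_partial b u Y d" "Y \<in> closed_half_space" "b \<in> Basis"
  shows "partial b u Y = d"
  using assms unfolding has_partial_def partial_def
  by (simp add: has_real_derivative_iff_has_vector_derivative line_within_nontrivial
      vector_derivative_within)

lemma differentiable_iff_has_partial:
  assumes "Y \<in> closed_half_space" "b \<in> Basis"
  shows "(\<lambda>s. u (Y + s *\<^sub>R b)) differentiable (at 0 within {s. Y + s *\<^sub>R b \<in> closed_half_space})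
    \<longleftrightarrow> has_partial b u Y (partial b u Y)"
  using has_partial_imp_partial[OF _ assms]
  unfolding has_partial_def real_differentiable_def by metis

lemma eventually_line_in:
  assumes "rel_open S" "Y \<in> S"
  shows "\<forall>\<^sub>F s in at 0 within {s. Y + s *\<^sub>R b \<in> closed_half_space}. Y + s *\<^sub>R b \<in> S"
proof -
  obtain T where T: "open T" "S = closed_half_space \<inter> T"
    using assms(1) unfolding rel_open_def openin_open by auto
  have "((\<lambda>s. Y + s *\<^sub>R b) \<longlongrightarrow> Y + 0 *\<^sub>R b) (at 0 within {s. Y + s *\<^sub>R b \<in> closed_half_space})"
    by (intro tendsto_intros)
  then have "\<forall>\<^sub>F s in at 0 within {s. Y + s *\<^sub>R b \<in> closed_half_space}. Y + s *\<^sub>R b \<in> T"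
    using T assms(2) by (intro topological_tendstoD) auto
  moreover have "\<forall>\<^sub>F s in at 0 within {s. Y + s *\<^sub>R b \<in> closed_half_space}. Y + s *\<^sub>R b \<in> closed_half_space"
    by (simp add: eventually_at_filter)
  ultimately show ?thesis
    by eventually_elim (simp add: T)
qed

lemma has_partial_cong:
  assumes "rel_open S" "Y \<in> S" "\<And>Y. Y \<in> S \<Longrightarrow> u Y = v Y"
  shows "has_partial b u Y d \<longleftrightarrow> has_partial b v Y d"
  unfolding has_partial_def
proof (rule has_field_derivative_cong_eventually)
  show "\<forall>\<^sub>F s in at 0 within {s. Y + s *\<^sub>R b \<in> closed_half_space}. u (Y + s *\<^sub>R b) = v (Y + s *\<^sub>R b)"
    using eventually_line_in[OF assms(1,2)] by (rule eventually_mono) (rule assms(3))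
qed (simp add: assms(2,3) del: split_paired_All)

text \<open>\<open>vector_derivative\<close> is a choice from a predicate, and the predicates for
  \<open>u\<close> and \<open>v\<close> coincide; so the equality also covers points where the
  derivative fails to exist.\<close>

lemma partial_cong:
  assumes "rel_open S" "Y \<in> S" "\<And>Y. Y \<in> S \<Longrightarrow> u Y = v Y"
  shows "partial b u Y = partial b v Y"
  using has_partial_cong[of S Y u v, OF assms]
  unfolding partial_def has_partial_def vector_derivative_def
  by (simp add: has_real_derivative_iff_has_vector_derivative)

lemma has_partial_add:
  "has_partial b u Y d \<Longrightarrow> has_partial b v Y e \<Longrightarrow> has_partial b (\<lambda>Y. u Y + v Y) Y (d + e)"
  unfolding has_partial_def by (rule DERIV_add)

lemma has_partial_mult:
  "has_partial b u Y d \<Longrightarrow> has_partial b v Y e \<Longrightarrow>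
    has_partial b (\<lambda>Y. u Y * v Y) Y (d * v Y + u Y * e)"
  unfolding has_partial_def by (auto intro!: derivative_eq_intros)

lemma has_partial_const: "has_partial b (\<lambda>Y. c) Y 0"
  unfolding has_partial_def by auto

section \<open>The classes C^k on relatively open sets\<close>

lemma Ck_on_imp_has_partial:
  assumes "Ck_on (Suc k) S u" "rel_open S" "b \<in> Basis" "Y \<in> S"
  shows "has_partial b u Y (partial b u Y)"
  using assms differentiable_iff_has_partial[OF rel_openD[OF assms(2,4)] assms(3), of u] by simp

lemma Ck_on_cong:
  assumes "rel_open S" "\<And>Y. Y \<in> S \<Longrightarrow> u Y = v Y"
  shows "Ck_on k S u \<longleftrightarrow> Ck_on k S v"
  using assms(2)
proof (induction k arbitrary: u v)
  case 0
  then show ?case by (simp cong: continuous_on_cong)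
next
  case (Suc k)
  have p: "partial b u Y = partial b v Y" if "Y \<in> S" for b Y
    using partial_cong[OF assms(1) that] Suc.prems by blast
  have c: "continuous_on S u \<longleftrightarrow> continuous_on S v"
    using Suc.prems by (simp cong: continuous_on_cong)
  have "Ck_on k S (partial b u) \<longleftrightarrow> Ck_on k S (partial b v)" for b
    using Suc.IH p by blast
  moreover have "(\<lambda>s. u (Y + s *\<^sub>R b)) differentiable (at 0 within {s. Y + s *\<^sub>R b \<in> closed_half_space})
    \<longleftrightarrow> (\<lambda>s. v (Y + s *\<^sub>R b)) differentiable (at 0 within {s. Y + s *\<^sub>R b \<in> closed_half_space})"
    if "Y \<in> S" "b \<in> Basis" for b Y
    using has_partial_cong[of S Y u v, OF assms(1) that(1) Suc.prems]
    unfolding has_partial_def real_differentiable_def by simp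
  ultimately show ?case by (auto simp: c)
qed

text \<open>Lets explicit formulas \<open>u'\<close>, valid only on \<open>S\<close>, stand in for
  \<open>partial b u\<close>; \<open>Ck_on_cong\<close> makes the exchange.\<close>

lemma Ck_on_SucI:
  assumes "rel_open S" "continuous_on S u"
    and "\<And>b Y. b \<in> Basis \<Longrightarrow> Y \<in> S \<Longrightarrow> has_partial b u Y (u' b Y)"
    and "\<And>b. b \<in> Basis \<Longrightarrow> Ck_on k S (u' b)"
  shows "Ck_on (Suc k) S u"
proof -
  have p: "partial b u Y = u' b Y" if "b \<in> Basis" "Y \<in> S" for b Y
    using assms(3) has_partial_imp_partial rel_openD[OF assms(1)] that by blast
  then have "Ck_on k S (partial b u)" if "b \<in> Basis" for b
    using Ck_on_cong[OF assms(1), of "partial b u" "u' b"] assms(4) that by blast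
  moreover have "has_partial b u Y (partial b u Y)" if "b \<in> Basis" "Y \<in> S" for b Y
    using p assms(3) that by simp
  ultimately show ?thesis
    unfolding Ck_on.simps
    using assms(2) differentiable_iff_has_partial rel_openD[OF assms(1)] by blast
qed

lemma Ck_on_SucD: "Ck_on (Suc k) S u \<Longrightarrow> Ck_on k S u"
  by (induction k arbitrary: u) auto

text \<open>Differentiability in \<open>Ck_on\<close> is tested along the closed half-space and not
  along \<open>S\<close>, so shrinking \<open>S\<close> merely restricts quantifiers and
  continuity.\<close>

lemma Ck_on_mono:
  assumes "Ck_on k S u" "T \<subseteq> S"
  shows "Ck_on k T u"
  using assms(1)
proof (induction k arbitrary: u)
  case 0
  then show ?case using assms(2) continuous_on_subset by auto
next
  case (Suc k)
  then show ?case using assms(2) continuous_on_subset by (auto 0 3)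
qed

lemma Ck_on_add:
  assumes "rel_open S" "Ck_on k S u" "Ck_on k S v"
  shows "Ck_on k S (\<lambda>Y. u Y + v Y)"
  using assms(2,3)
proof (induction k arbitrary: u v)
  case 0
  then show ?case by (simp add: continuous_on_add)
next
  case (Suc k)
  show ?case
  proof (rule Ck_on_SucI[OF assms(1)])
    show "continuous_on S (\<lambda>Y. u Y + v Y)"
      using Suc.prems by (simp add: continuous_on_add)
    show "has_partial b (\<lambda>Y. u Y + v Y) Y (partial b u Y + partial b v Y)"
      if "b \<in> Basis" "Y \<in> S" for b Y
      using Ck_on_imp_has_partial Suc.prems assms(1) that by (intro has_partial_add) blast+
    show "Ck_on k S (\<lambda>Y. partial b u Y + partial b v Y)" if "b \<in> Basis" for b
      using Suc that by simp
  qed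
qed

lemma Ck_on_mult:
  assumes "rel_open S" "Ck_on k S u" "Ck_on k S v"
  shows "Ck_on k S (\<lambda>Y. u Y * v Y)"
  using assms(2,3)
proof (induction k arbitrary: u v)
  case 0
  then show ?case by (simp add: continuous_on_mult)
next
  case (Suc k)
  \<comment> \<open>The product rule keeps one factor undifferentiated, so the induction hypothesis
    also needs \<open>u\<close> and \<open>v\<close> themselves in class C^k.\<close>
  note low = Suc.prems[THEN Ck_on_SucD]
  show ?case
  proof (rule Ck_on_SucI[OF assms(1)])
    show "continuous_on S (\<lambda>Y. u Y * v Y)"
      using Suc.prems by (simp add: continuous_on_mult)
    show "has_partial b (\<lambda>Y. u Y * v Y) Y (partial b u Y * v Y + u Y * partial b v Y)"
      if "b \<in> Basis" "Y \<in> S" for b Y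
      using Ck_on_imp_has_partial Suc.prems assms(1) that by (intro has_partial_mult) blast+
    show "Ck_on k S (\<lambda>Y. partial b u Y * v Y + u Y * partial b v Y)" if "b \<in> Basis" for b
      using Suc low that by (intro Ck_on_add[OF assms(1)] Suc.IH) auto
  qed
qed

lemma Ck_on_const: "rel_open S \<Longrightarrow> Ck_on k S (\<lambda>Y. c)"
proof (induction k arbitrary: c)
  case (Suc k)
  then show ?case by (intro Ck_on_SucI[where u' = "\<lambda>b Y. 0"]) (auto simp: has_partial_const)
qed simp

lemma has_partial_snd: "has_partial b snd Y (snd b)"
  unfolding has_partial_def by (auto intro!: derivative_eq_intros)

lemma Ck_on_snd: "rel_open S \<Longrightarrow> Ck_on k S snd"
proof (induction k)
  case (Suc k)
  then show ?case
    by (intro Ck_on_SucI[where u' = "\<lambda>b Y. snd b"])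
      (auto simp: has_partial_snd Ck_on_const continuous_on_snd)
qed (simp add: continuous_on_snd)

lemma has_partial_inner: "has_partial b (\<lambda>Y. (Y - Z) \<bullet> v) Y (b \<bullet> v)"
  unfolding has_partial_def by (auto intro!: derivative_eq_intros simp: inner_simps)

lemma Ck_on_inner: "rel_open S \<Longrightarrow> Ck_on k S (\<lambda>Y. (Y - Z) \<bullet> v)"
proof (induction k)
  case (Suc k)
  then show ?case
    by (intro Ck_on_SucI[where u' = "\<lambda>b Y. b \<bullet> v"])
      (auto simp: has_partial_inner Ck_on_const intro!: continuous_intros)
qed (auto intro!: continuous_intros)

subsection \<open>Powers of the distance to a pole\<close>

text \<open>The exponent sits on the squared distance, so this is |Y - Z|^(2p); each derivative
  lowers \<open>p\<close> by 1 and brings out a factor linear in \<open>Y - Z\<close>.\<close>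

definition dist_pow :: "'n::finite pt \<Rightarrow> real \<Rightarrow> 'n pt \<Rightarrow> real"
  where "dist_pow Z p Y = ((Y - Z) \<bullet> (Y - Z)) powr p"

lemma has_partial_dist_pow:
  assumes "Y \<noteq> Z"
  shows "has_partial b (dist_pow Z p) Y (2 * p * ((Y - Z) \<bullet> b) * dist_pow Z (p - 1) Y)"
proof -
  have "((\<lambda>s. (Y + s *\<^sub>R b - Z) \<bullet> (Y + s *\<^sub>R b - Z)) has_real_derivative 2 * ((Y - Z) \<bullet> b))
      (at 0 within {s. Y + s *\<^sub>R b \<in> closed_half_space})"
  proof -
    \<comment> \<open>Along a line the squared distance is a quadratic polynomial in
      \<open>s\<close>, whose linear coefficient is the derivative at 0.\<close>
    have eq: "(\<lambda>s. (Y + s *\<^sub>R b - Z) \<bullet> (Y + s *\<^sub>R b - Z)) =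
        (\<lambda>s. (Y - Z) \<bullet> (Y - Z) + s * (2 * ((Y - Z) \<bullet> b)) + s * s * (b \<bullet> b))"
      by (simp add: fun_eq_iff algebra_simps inner_add_left inner_add_right inner_diff_left inner_diff_right
          inner_commute)
    show ?thesis
      unfolding eq by (auto intro!: derivative_eq_intros)
  qed
  then show ?thesis
    unfolding has_partial_def dist_pow_def
    using assms by (auto intro!: derivative_eq_intros simp: field_simps)
qed

lemma continuous_on_dist_pow: "Z \<notin> S \<Longrightarrow> continuous_on S (dist_pow Z p)"
  unfolding dist_pow_def[abs_def] by (auto intro!: continuous_intros)

text \<open>A derivative is a linear function times the power with exponent \<open>p - 1\<close>, so
  the induction runs over all \<open>p\<close> at once.\<close>

lemma Ck_on_dist_pow:
  assumes "rel_open S" "Z \<notin> S"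
  shows "Ck_on k S (dist_pow Z p)"
proof (induction k arbitrary: p)
  case 0
  then show ?case using assms continuous_on_dist_pow by simp
next
  case (Suc k)
  show ?case
  proof (rule Ck_on_SucI[OF assms(1) continuous_on_dist_pow[OF assms(2)]])
    show "has_partial b (dist_pow Z p) Y (2 * p * ((Y - Z) \<bullet> b) * dist_pow Z (p - 1) Y)"
      if "b \<in> Basis" "Y \<in> S" for b Y
      using that assms(2) by (intro has_partial_dist_pow) auto
    show "Ck_on k S (\<lambda>Y. 2 * p * ((Y - Z) \<bullet> b) * dist_pow Z (p - 1) Y)" for b
      using assms(1) Suc by (intro Ck_on_mult Ck_on_const Ck_on_inner) auto
  qed
qed

section \<open>Linearity and locality of the differential operators\<close>

lemma Ck_on_partial: "Ck_on (Suc k) S u \<Longrightarrow> b \<in> Basis \<Longrightarrow> Ck_on k S (partial b u)"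
  by simp

lemma Ck_on_sum:
  assumes "rel_open S" "\<And>i. i \<in> A \<Longrightarrow> Ck_on k S (f i)"
  shows "Ck_on k S (\<lambda>Y. \<Sum>i\<in>A. f i Y)"
  using assms(2)
proof (induction A rule: infinite_finite_induct)
  case (insert i A)
  then show ?case
    using Ck_on_add[OF assms(1), of k "f i" "\<lambda>Y. \<Sum>i\<in>A. f i Y"] by simp
qed (use Ck_on_const[OF assms(1)] in simp_all)

lemma partial_lin:
  assumes "rel_open S" "Ck_on (Suc k) S u" "Ck_on (Suc k) S v" "b \<in> Basis" "Y \<in> S"
  shows "partial b (\<lambda>Y. a * u Y + c * v Y) Y = a * partial b u Y + c * partial b v Y"
proof -
  have "has_partial b (\<lambda>Y. a * u Y) Y (0 * u Y + a * partial b u Y)"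
    "has_partial b (\<lambda>Y. c * v Y) Y (0 * v Y + c * partial b v Y)"
    by (rule has_partial_mult[OF has_partial_const Ck_on_imp_has_partial[OF _ assms(1,4,5)]],
        rule assms(2,3))+
  from has_partial_imp_partial[OF has_partial_add[OF this] rel_openD[OF assms(1,5)] assms(4)]
  show ?thesis by simp
qed

lemma partial_partial_lin:
  assumes "rel_open S" "Ck_on (Suc (Suc k)) S u" "Ck_on (Suc (Suc k)) S v" "b \<in> Basis" "b' \<in> Basis" "Y \<in> S"
  shows "partial b' (partial b (\<lambda>Y. a * u Y + c * v Y)) Y =
    a * partial b' (partial b u) Y + c * partial b' (partial b v) Y"
proof -
  have "partial b' (partial b (\<lambda>Y. a * u Y + c * v Y)) Y =
      partial b' (\<lambda>Y. a * partial b u Y + c * partial b v Y) Y"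
    using partial_lin[OF assms(1-4)] by (intro partial_cong[OF assms(1,6)])
  then show ?thesis
    using partial_lin[OF assms(1) Ck_on_partial[OF assms(2,4)] Ck_on_partial[OF assms(3,4)] assms(5,6)]
    by simp
qed

lemma normal_in_Basis: "(0, 1) \<in> (Basis :: 'n::finite pt set)"
  and tangent_in_Basis: "e \<in> Basis \<Longrightarrow> (e, 0) \<in> (Basis :: 'n::finite pt set)"
  by (simp_all add: Basis_pt)

lemma laplace_tan_lin:
  assumes "rel_open S" "Ck_on (Suc (Suc k)) S u" "Ck_on (Suc (Suc k)) S v" "Y \<in> S"
  shows "laplace_tan (\<lambda>Y. a * u Y + c * v Y) Y = a * laplace_tan u Y + c * laplace_tan v Y"
  unfolding laplace_tan_def sum_distrib_left sum.distrib[symmetric]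
  by (intro sum.cong refl partial_partial_lin[OF assms(1-3) _ _ assms(4)] tangent_in_Basis)

lemma laplace_lin:
  assumes "rel_open S" "Ck_on (Suc (Suc k)) S u" "Ck_on (Suc (Suc k)) S v" "Y \<in> S"
  shows "laplace (\<lambda>Y. a * u Y + c * v Y) Y = a * laplace u Y + c * laplace v Y"
  unfolding laplace_def sum_distrib_left sum.distrib[symmetric]
  by (intro sum.cong refl partial_partial_lin[OF assms(1-3) _ _ assms(4)])

lemma partial_partial_cong:
  assumes "rel_open S" "Y \<in> S" "\<And>Y. Y \<in> S \<Longrightarrow> u Y = v Y"
  shows "partial b' (partial b u) Y = partial b' (partial b v) Y"
proof (rule partial_cong[OF assms(1,2)])
  show "partial b u X = partial b v X" if "X \<in> S" for X
    by (rule partial_cong[OF assms(1) that assms(3)])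
qed

lemma laplace_tan_cong:
  assumes "rel_open S" "Y \<in> S" "\<And>Y. Y \<in> S \<Longrightarrow> u Y = v Y"
  shows "laplace_tan u Y = laplace_tan v Y"
  unfolding laplace_tan_def using partial_partial_cong[of S Y u v, OF assms] by simp

lemma laplace_cong:
  assumes "rel_open S" "Y \<in> S" "\<And>Y. Y \<in> S \<Longrightarrow> u Y = v Y"
  shows "laplace u Y = laplace v Y"
  unfolding laplace_def using partial_partial_cong[of S Y u v, OF assms] by simp

lemma laplace_eq_laplace_tan: "laplace u Y = laplace_tan u Y + partial_t (partial_t u) Y"
  unfolding laplace_def laplace_tan_def partial_t_def Basis_pt
  by (subst sum.union_disjoint) (auto simp: sum.reindex inj_on_def)

lemma Ck_on_laplace: "rel_open S \<Longrightarrow> Ck_on (Suc (Suc k)) S u \<Longrightarrow> Ck_on k S (laplace u)"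
  unfolding laplace_def[abs_def] by (intro Ck_on_sum Ck_on_partial)

lemma Ck_on_partial_t: "Ck_on (Suc k) S u \<Longrightarrow> Ck_on k S (partial_t u)"
  unfolding partial_t_def by (intro Ck_on_partial normal_in_Basis)

lemma bdry_op_simps:
  "bdry_op 0 u Y = u Y"
  "bdry_op (Suc 0) u Y = - partial_t u Y"
  "bdry_op 2 u Y = partial_t (partial_t u) Y - laplace_tan u Y"
  "bdry_op 3 u Y = partial_t (laplace u) Y + 2 * laplace_tan (partial_t u) Y"
  by (simp_all add: bdry_op_def numeral_2_eq_2 numeral_3_eq_3)

text \<open>C^3 is the regularity that the operator of order 3 requires. Linearity of the inner
  operator holds on all of \<open>S\<close>, so the congruence rules carry it under the outer
  derivative.\<close>

lemma bdry_op_lin: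
  assumes "rel_open S" "Ck_on 3 S u" "Ck_on 3 S v" "Y \<in> S" "k \<le> 3"
  shows "bdry_op k (\<lambda>Y. a * u Y + c * v Y) Y = a * bdry_op k u Y + c * bdry_op k v Y"
proof -
  have u: "Ck_on (Suc (Suc (Suc 0))) S u" and v: "Ck_on (Suc (Suc (Suc 0))) S v"
    using assms(2,3) by (simp_all only: numeral_3_eq_3)
  note u' = Ck_on_partial_t[OF u] and v' = Ck_on_partial_t[OF v]
  let ?w = "\<lambda>Y. a * u Y + c * v Y"
  have t: "partial_t ?w X = a * partial_t u X + c * partial_t v X" if "X \<in> S" for X
    unfolding partial_t_def by (rule partial_lin[OF assms(1) u v normal_in_Basis that])
  have l: "laplace ?w X = a * laplace u X + c * laplace v X" if "X \<in> S" for X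
    by (rule laplace_lin[OF assms(1) u v that])
  have tt: "partial_t (partial_t ?w) Y = a * partial_t (partial_t u) Y + c * partial_t (partial_t v) Y"
    unfolding partial_t_def
    by (rule partial_partial_lin[OF assms(1) u v normal_in_Basis normal_in_Basis assms(4)])
  have "partial_t (laplace ?w) Y = partial_t (\<lambda>X. a * laplace u X + c * laplace v X) Y"
    unfolding partial_t_def by (rule partial_cong[OF assms(1,4) l])
  also have "\<dots> = a * partial_t (laplace u) Y + c * partial_t (laplace v) Y"
    unfolding partial_t_def
    by (rule partial_lin[OF assms(1) Ck_on_laplace[OF assms(1) u] Ck_on_laplace[OF assms(1) v]
          normal_in_Basis assms(4)])
  finally have tl: "partial_t (laplace ?w) Y = a * partial_t (laplace u) Y + c * partial_t (laplace v) Y" .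
  have "laplace_tan (partial_t ?w) Y = laplace_tan (\<lambda>X. a * partial_t u X + c * partial_t v X) Y"
    by (rule laplace_tan_cong[OF assms(1,4) t])
  also have "\<dots> = a * laplace_tan (partial_t u) Y + c * laplace_tan (partial_t v) Y"
    by (rule laplace_tan_lin[OF assms(1) u' v' assms(4)])
  finally have lt: "laplace_tan (partial_t ?w) Y = a * laplace_tan (partial_t u) Y + c * laplace_tan (partial_t v) Y" .
  have "laplace_tan ?w Y = a * laplace_tan u Y + c * laplace_tan v Y"
    by (rule laplace_tan_lin[OF assms(1) u v assms(4)])
  moreover have "k \<in> {0, 1, 2, 3}"
    using assms(5) by auto
  ultimately show ?thesis
    using t[OF assms(4)] tt tl lt by (auto simp: bdry_op_simps algebra_simps)
qed

lemma has_partial_tangent_mult: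
  assumes "has_partial (e, 0) u Y d"
  shows "has_partial (e, 0) (\<lambda>Y. \<phi> (snd Y) * u Y) Y (\<phi> (snd Y) * d)"
  using assms DERIV_cmult unfolding has_partial_def by fastforce

text \<open>A function of the normal coordinate is constant along tangential lines, so it passes
  through both derivatives as a scalar.\<close>

lemma laplace_tan_mult_normal:
  assumes "rel_open S" "Ck_on (Suc (Suc k)) S u" "Y \<in> S"
  shows "laplace_tan (\<lambda>Y. \<phi> (snd Y) * u Y) Y = \<phi> (snd Y) * laplace_tan u Y"
proof -
  have p: "partial (e, 0) (\<lambda>Y. \<phi> (snd Y) * v Y) X = \<phi> (snd X) * partial (e, 0) v X"
    if "e \<in> Basis" "Ck_on (Suc j) S v" "X \<in> S" for e v X j
    using Ck_on_imp_has_partial[OF that(2) assms(1) tangent_in_Basis that(3)] that(1)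
    by (intro has_partial_imp_partial has_partial_tangent_mult rel_openD[OF assms(1) that(3)]
        tangent_in_Basis)
  have "partial (e, 0) (partial (e, 0) (\<lambda>Y. \<phi> (snd Y) * u Y)) Y =
      \<phi> (snd Y) * partial (e, 0) (partial (e, 0) u) Y" if e: "e \<in> Basis" for e
  proof -
    have "partial (e, 0) (partial (e, 0) (\<lambda>Y. \<phi> (snd Y) * u Y)) Y =
        partial (e, 0) (\<lambda>X. \<phi> (snd X) * partial (e, 0) u X) Y"
      by (rule partial_cong[OF assms(1,3)]) (rule p[OF e assms(2)])
    also have "\<dots> = \<phi> (snd Y) * partial (e, 0) (partial (e, 0) u) Y"
      by (rule p[OF e Ck_on_partial[OF assms(2) tangent_in_Basis[OF e]] assms(3)])
    finally show ?thesis .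
  qed
  then show ?thesis
    by (simp add: laplace_tan_def sum_distrib_left)
qed

section \<open>Explicit derivatives of powers of the distance with a linear normal factor\<close>

lemma inner_mult_dist_pow:
  "Y \<noteq> Z \<Longrightarrow> ((Y - Z) \<bullet> (Y - Z)) * dist_pow Z p Y = dist_pow Z (p + 1) Y"
  by (simp add: dist_pow_def powr_add)

text \<open>With w = |Y - Z|^2 and y the tangential part of Y - Z, the second derivatives sum to 2pn
  w^(p-1) + 4p(p-1)|y|^2 w^(p-2). Replacing |y|^2 by w minus the squared normal part leaves
  coefficients in the normal coordinate only.\<close>

lemma laplace_tan_dist_pow:
  fixes Z :: "'n::finite pt"
  assumes "Y \<in> closed_half_space - {Z}"
  shows "laplace_tan (dist_pow Z p) Y =
    2 * p * (real CARD('n) + 2 * p - 2) * dist_pow Z (p - 1) Y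
    - 4 * p * (p - 1) * (snd Y - snd Z)\<^sup>2 * dist_pow Z (p - 2) Y"
proof -
  let ?S = "closed_half_space - {Z}"
  note S = rel_open_punctured[of Z]
  have p1: "partial (e, 0) (dist_pow Z p) X = 2 * p * ((X - Z) \<bullet> (e, 0)) * dist_pow Z (p - 1) X"
    if "e \<in> Basis" "X \<in> ?S" for e X
    using that by (intro has_partial_imp_partial has_partial_dist_pow tangent_in_Basis) auto
  have p2: "partial (e, 0) (partial (e, 0) (dist_pow Z p)) Y =
      2 * p * dist_pow Z (p - 1) Y + 4 * p * (p - 1) * (((fst Y - fst Z) \<bullet> e) * ((fst Y - fst Z) \<bullet> e)) * dist_pow Z (p - 2) Y"
    if e: "e \<in> Basis" for e
  proof -
    have i: "has_partial (e, 0) (\<lambda>X. 2 * p * ((X - Z) \<bullet> (e, 0))) Y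
        (0 * ((Y - Z) \<bullet> (e, 0)) + 2 * p * ((e, 0::real) \<bullet> (e, 0)))"
      by (rule has_partial_mult[OF has_partial_const has_partial_inner])
    have q: "has_partial (e, 0) (dist_pow Z (p - 1)) Y
        (2 * (p - 1) * ((Y - Z) \<bullet> (e, 0)) * dist_pow Z (p - 1 - 1) Y)"
      using assms by (intro has_partial_dist_pow) auto
    have "partial (e, 0) (partial (e, 0) (dist_pow Z p)) Y =
        partial (e, 0) (\<lambda>X. 2 * p * ((X - Z) \<bullet> (e, 0)) * dist_pow Z (p - 1) X) Y"
      by (rule partial_cong[OF S assms]) (rule p1[OF e])
    also have "\<dots> = (0 * ((Y - Z) \<bullet> (e, 0)) + 2 * p * ((e, 0::real) \<bullet> (e, 0))) * dist_pow Z (p - 1) Y +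
        2 * p * ((Y - Z) \<bullet> (e, 0)) * (2 * (p - 1) * ((Y - Z) \<bullet> (e, 0)) * dist_pow Z (p - 1 - 1) Y)"
      using assms e
      by (intro has_partial_imp_partial[OF has_partial_mult[OF i q]] tangent_in_Basis) auto
    finally show ?thesis
      using e by (simp add: inner_prod_def algebra_simps)
  qed
  have "laplace_tan (dist_pow Z p) Y = real CARD('n) * (2 * p * dist_pow Z (p - 1) Y) +
      4 * p * (p - 1) * ((fst Y - fst Z) \<bullet> (fst Y - fst Z)) * dist_pow Z (p - 2) Y"
    unfolding laplace_tan_def
    by (subst euclidean_inner) (simp add: p2 sum.distrib sum_distrib_left sum_distrib_right)
  also have "(fst Y - fst Z) \<bullet> (fst Y - fst Z) = (Y - Z) \<bullet> (Y - Z) - (snd Y - snd Z)\<^sup>2"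
    by (simp add: inner_prod_def power2_eq_square)
  also have "real CARD('n) * (2 * p * dist_pow Z (p - 1) Y) +
      4 * p * (p - 1) * ((Y - Z) \<bullet> (Y - Z) - (snd Y - snd Z)\<^sup>2) * dist_pow Z (p - 2) Y =
      real CARD('n) * (2 * p * dist_pow Z (p - 1) Y) +
      4 * p * (p - 1) * (((Y - Z) \<bullet> (Y - Z)) * dist_pow Z (p - 2) Y) -
      4 * p * (p - 1) * (snd Y - snd Z)\<^sup>2 * dist_pow Z (p - 2) Y"
    by (simp add: algebra_simps)
  also have "((Y - Z) \<bullet> (Y - Z)) * dist_pow Z (p - 2) Y = dist_pow Z (p - 1) Y"
    using inner_mult_dist_pow[of Y Z "p - 2"] assms by simp
  finally show ?thesis
    by (simp add: algebra_simps)
qed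

text \<open>A family that contains the fundamental solution (\<beta> = 0) and s r^(1-n), and that
  \<open>laplace\<close> maps to itself off the pole. Measuring the linear factor from the pole
  decouples the two coefficients.\<close>

definition lin_dist_pow :: "real \<Rightarrow> real \<Rightarrow> 'n::finite pt \<Rightarrow> real \<Rightarrow> 'n pt \<Rightarrow> real"
  where "lin_dist_pow \<alpha> \<beta> Z p Y = (\<alpha> + \<beta> * (snd Y - snd Z)) * dist_pow Z p Y"

lemma Ck_on_lin_dist_pow:
  assumes "rel_open S" "Z \<notin> S"
  shows "Ck_on k S (lin_dist_pow \<alpha> \<beta> Z p)"
proof -
  have "Ck_on k S (\<lambda>Y. (\<alpha> + \<beta> * (snd Y + - snd Z)) * dist_pow Z p Y)"
    by (intro Ck_on_mult Ck_on_add Ck_on_const Ck_on_snd Ck_on_dist_pow assms)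
  then show ?thesis
    by (simp add: lin_dist_pow_def[abs_def])
qed

lemma has_partial_t_dist_pow:
  assumes "Y \<noteq> Z"
  shows "has_partial (0, 1) (dist_pow Z p) Y (2 * p * (snd Y - snd Z) * dist_pow Z (p - 1) Y)"
  using has_partial_dist_pow[OF assms, of "(0, 1)" p] by (simp add: inner_prod_def)

lemma has_partial_t_normal:
  assumes "(f has_real_derivative f') (at (snd Y))"
  shows "has_partial (0, 1) (\<lambda>Y. f (snd Y)) Y f'"
proof -
  have "((\<lambda>s. f (snd Y + s)) has_real_derivative f') (at 0)"
    using assms DERIV_at_within_shift[of f f' "snd Y" 0 UNIV] by (simp add: add.commute)
  then show ?thesis
    unfolding has_partial_def by (simp add: has_field_derivative_at_within)
qed

lemma partial_t_normal_mult_dist_pow: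
  assumes "Y \<in> closed_half_space - {Z}" "(f has_real_derivative f') (at (snd Y))"
  shows "partial_t (\<lambda>Y. f (snd Y) * dist_pow Z p Y) Y =
    f' * dist_pow Z p Y + f (snd Y) * (2 * p * (snd Y - snd Z) * dist_pow Z (p - 1) Y)"
  unfolding partial_t_def using assms
  by (intro has_partial_imp_partial[OF has_partial_mult[OF has_partial_t_normal has_partial_t_dist_pow]]
      normal_in_Basis) auto

lemma partial_t_lin_dist_pow:
  fixes Z Y :: "'n::finite pt"
  assumes Y: "Y \<in> closed_half_space - {Z}"
  shows "partial_t (lin_dist_pow \<alpha> \<beta> Z p) Y =
    \<beta> * dist_pow Z p Y + 2 * p * ((snd Y - snd Z) * (\<alpha> + \<beta> * (snd Y - snd Z))) * dist_pow Z (p - 1) Y"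
  unfolding lin_dist_pow_def[abs_def]
  by (subst partial_t_normal_mult_dist_pow[OF Y, where f = "\<lambda>s. \<alpha> + \<beta> * (s - snd Z)" and f' = \<beta>])
    (auto intro!: derivative_eq_intros)

lemma laplace_tan_lin_dist_pow:
  fixes Z Y :: "'n::finite pt"
  assumes Y: "Y \<in> closed_half_space - {Z}"
  shows "laplace_tan (lin_dist_pow \<alpha> \<beta> Z p) Y = (\<alpha> + \<beta> * (snd Y - snd Z)) *
    (2 * p * (real CARD('n) + 2 * p - 2) * dist_pow Z (p - 1) Y
     - 4 * p * (p - 1) * (snd Y - snd Z)\<^sup>2 * dist_pow Z (p - 2) Y)"
  unfolding lin_dist_pow_def[abs_def]
  by (subst laplace_tan_mult_normal[where \<phi> = "\<lambda>s. \<alpha> + \<beta> * (s - snd Z)",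
        OF rel_open_punctured Ck_on_dist_pow[OF rel_open_punctured] Y])
    (simp_all add: laplace_tan_dist_pow[OF Y])

text \<open>Regularity of the term with a quadratic normal factor that \<open>partial_t\<close>
  produces from \<open>lin_dist_pow\<close>, so that it can be differentiated again.\<close>

lemma Ck_on_normal_dist_pow:
  assumes "rel_open S" "Z \<notin> S"
  shows "Ck_on k S (\<lambda>Y. ((snd Y - snd Z) * (\<alpha> + \<beta> * (snd Y - snd Z))) * dist_pow Z p Y)"
proof -
  have "Ck_on k S (\<lambda>Y. ((snd Y + - snd Z) * (\<alpha> + \<beta> * (snd Y + - snd Z))) * dist_pow Z p Y)"
    by (intro Ck_on_mult Ck_on_add Ck_on_const Ck_on_snd Ck_on_dist_pow assms)
  then show ?thesis by simp
qed

lemma partial_t_partial_t_lin_dist_pow: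
  fixes Z Y :: "'n::finite pt"
  assumes Y: "Y \<in> closed_half_space - {Z}"
  shows "partial_t (partial_t (lin_dist_pow \<alpha> \<beta> Z p)) Y =
    2 * p * (\<alpha> + 3 * \<beta> * (snd Y - snd Z)) * dist_pow Z (p - 1) Y
    + 4 * p * (p - 1) * (snd Y - snd Z)\<^sup>2 * (\<alpha> + \<beta> * (snd Y - snd Z)) * dist_pow Z (p - 2) Y"
proof -
  let ?f = "\<lambda>s. (s - snd Z) * (\<alpha> + \<beta> * (s - snd Z))"
  let ?u = "dist_pow Z p" and ?v = "\<lambda>Y. ?f (snd Y) * dist_pow Z (p - 1) Y"
  note S = rel_open_punctured[of Z]
  have u: "Ck_on (Suc 0) (closed_half_space - {Z}) ?u"
    by (rule Ck_on_dist_pow[OF S]) simp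
  have v: "Ck_on (Suc 0) (closed_half_space - {Z}) ?v"
    by (rule Ck_on_normal_dist_pow[OF S]) simp
  have "partial_t (partial_t (lin_dist_pow \<alpha> \<beta> Z p)) Y = partial_t (\<lambda>Y. \<beta> * ?u Y + 2 * p * ?v Y) Y"
    unfolding partial_t_def[abs_def]
    by (rule partial_cong[OF S Y]) (simp add: partial_t_lin_dist_pow flip: partial_t_def)
  also have "\<dots> = \<beta> * partial_t ?u Y + 2 * p * partial_t ?v Y"
    unfolding partial_t_def by (rule partial_lin[OF S u v normal_in_Basis Y])
  also have "partial_t ?v Y = (\<alpha> + 2 * \<beta> * (snd Y - snd Z)) * dist_pow Z (p - 1) Y +
      ?f (snd Y) * (2 * (p - 1) * (snd Y - snd Z) * dist_pow Z (p - 1 - 1) Y)"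
    by (rule partial_t_normal_mult_dist_pow[OF Y]) (auto intro!: derivative_eq_intros simp: algebra_simps)
  also have "partial_t ?u Y = 2 * p * (snd Y - snd Z) * dist_pow Z (p - 1) Y"
    unfolding partial_t_def using Y
    by (intro has_partial_imp_partial[OF has_partial_t_dist_pow] normal_in_Basis) auto
  finally show ?thesis
    by (simp add: algebra_simps power2_eq_square)
qed

text \<open>The terms with exponent p - 2 cancel between the tangential and the normal part. To 2p(n
  + 2p - 2) the normal part then adds 2p for \<alpha> and 6p for \<beta>.\<close>

lemma laplace_lin_dist_pow:
  fixes Z Y :: "'n::finite pt"
  assumes Y: "Y \<in> closed_half_space - {Z}"
  shows "laplace (lin_dist_pow \<alpha> \<beta> Z p) Y =
    lin_dist_pow (2 * p * (real CARD('n) - 1 + 2 * p) * \<alpha>) (2 * p * (real CARD('n) + 1 + 2 * p) * \<beta>) Z (p - 1) Y"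
  unfolding laplace_eq_laplace_tan partial_t_partial_t_lin_dist_pow[OF Y] laplace_tan_lin_dist_pow[OF Y]
  by (simp add: lin_dist_pow_def algebra_simps power2_eq_square)

lemma laplace_laplace_lin_dist_pow:
  fixes Z Y :: "'n::finite pt"
  assumes Y: "Y \<in> closed_half_space - {Z}"
  shows "laplace (laplace (lin_dist_pow \<alpha> \<beta> Z p)) Y =
    lin_dist_pow
      (2 * (p - 1) * (real CARD('n) - 3 + 2 * p) * (2 * p * (real CARD('n) - 1 + 2 * p) * \<alpha>))
      (2 * (p - 1) * (real CARD('n) - 1 + 2 * p) * (2 * p * (real CARD('n) + 1 + 2 * p) * \<beta>)) Z (p - 2) Y"
proof -
  have "laplace (laplace (lin_dist_pow \<alpha> \<beta> Z p)) Y = laplace (lin_dist_pow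
      (2 * p * (real CARD('n) - 1 + 2 * p) * \<alpha>) (2 * p * (real CARD('n) + 1 + 2 * p) * \<beta>) Z (p - 1)) Y"
    by (rule laplace_cong[OF rel_open_punctured Y laplace_lin_dist_pow])
  then show ?thesis
    by (simp add: laplace_lin_dist_pow[OF Y] algebra_simps)
qed

lemma partial_t_laplace_lin_dist_pow:
  fixes Z Y :: "'n::finite pt"
  assumes Y: "Y \<in> closed_half_space - {Z}"
  shows "partial_t (laplace (lin_dist_pow \<alpha> \<beta> Z p)) Y =
    2 * p * (real CARD('n) + 1 + 2 * p) * \<beta> * dist_pow Z (p - 1) Y
    + 4 * p * (p - 1) * (snd Y - snd Z) * ((real CARD('n) - 1 + 2 * p) * \<alpha>
        + (real CARD('n) + 1 + 2 * p) * \<beta> * (snd Y - snd Z)) * dist_pow Z (p - 2) Y"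
proof -
  have "partial_t (laplace (lin_dist_pow \<alpha> \<beta> Z p)) Y = partial_t (lin_dist_pow
      (2 * p * (real CARD('n) - 1 + 2 * p) * \<alpha>) (2 * p * (real CARD('n) + 1 + 2 * p) * \<beta>) Z (p - 1)) Y"
    unfolding partial_t_def by (rule partial_cong[OF rel_open_punctured Y laplace_lin_dist_pow])
  then show ?thesis
    by (simp add: partial_t_lin_dist_pow[OF Y] algebra_simps)
qed

lemma laplace_tan_partial_t_lin_dist_pow:
  fixes Z Y :: "'n::finite pt"
  assumes Y: "Y \<in> closed_half_space - {Z}"
  shows "laplace_tan (partial_t (lin_dist_pow \<alpha> \<beta> Z p)) Y =
    \<beta> * (2 * p * (real CARD('n) + 2 * p - 2) * dist_pow Z (p - 1) Y
         - 4 * p * (p - 1) * (snd Y - snd Z)\<^sup>2 * dist_pow Z (p - 2) Y)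
    + 2 * p * ((snd Y - snd Z) * (\<alpha> + \<beta> * (snd Y - snd Z))) *
      (2 * (p - 1) * (real CARD('n) + 2 * p - 4) * dist_pow Z (p - 2) Y
       - 4 * (p - 1) * (p - 2) * (snd Y - snd Z)\<^sup>2 * dist_pow Z (p - 3) Y)"
proof -
  let ?f = "\<lambda>s. (s - snd Z) * (\<alpha> + \<beta> * (s - snd Z))"
  let ?u = "dist_pow Z p" and ?v = "\<lambda>Y. ?f (snd Y) * dist_pow Z (p - 1) Y"
  note S = rel_open_punctured[of Z]
  have D: "Ck_on (Suc (Suc 0)) (closed_half_space - {Z}) (dist_pow Z q)" for q
    by (rule Ck_on_dist_pow[OF S]) simp
  have v: "Ck_on (Suc (Suc 0)) (closed_half_space - {Z}) ?v"
    by (rule Ck_on_normal_dist_pow[OF S]) simp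
  have "laplace_tan (partial_t (lin_dist_pow \<alpha> \<beta> Z p)) Y = laplace_tan (\<lambda>Y. \<beta> * ?u Y + 2 * p * ?v Y) Y"
    by (rule laplace_tan_cong[OF S Y]) (simp add: partial_t_lin_dist_pow)
  also have "\<dots> = \<beta> * laplace_tan ?u Y + 2 * p * laplace_tan ?v Y"
    by (rule laplace_tan_lin[OF S D v Y])
  also have "laplace_tan ?v Y = ?f (snd Y) * laplace_tan (dist_pow Z (p - 1)) Y"
    by (rule laplace_tan_mult_normal[OF S D Y])
  finally show ?thesis
    by (simp add: laplace_tan_dist_pow[OF Y] algebra_simps)
qed

lemmas lin_dist_pow_derivs = partial_t_lin_dist_pow laplace_tan_lin_dist_pow
  partial_t_partial_t_lin_dist_pow partial_t_laplace_lin_dist_pow laplace_tan_partial_t_lin_dist_pow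

section \<open>Reflection of the pole in the boundary\<close>

lemma reflect_simps [simp]: "fst (reflect X) = fst X" "snd (reflect X) = - snd X"
  by (simp_all add: reflect_def)

lemma dist_pow_reflect:
  assumes "Y \<in> half_space_boundary"
  shows "dist_pow (reflect X) p Y = dist_pow X p Y"
  using assms by (simp add: dist_pow_def half_space_boundary_def inner_prod_def)

lemma boundary_in_punctured:
  assumes "X \<in> half_space" "Y \<in> half_space_boundary"
  shows "Y \<in> closed_half_space - {X}" "Y \<in> closed_half_space - {reflect X}"
  using assms by (auto simp: half_space_def half_space_boundary_def closed_half_space_def reflect_def)

text \<open>At a boundary point both poles are equally far away, and \<open>snd Y - snd Z\<close>
  only changes sign; it enters the operator of order \<open>k\<close> with the parity of
  \<open>k\<close>.\<close>

lemma bdry_op_reflect: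
  assumes "X \<in> half_space" "Y \<in> half_space_boundary" "k \<le> 3"
  shows "bdry_op k (lin_dist_pow c 0 (reflect X) p) Y = (-1) ^ k * bdry_op k (lin_dist_pow c 0 X p) Y"
proof -
  note in_S = boundary_in_punctured[OF assms(1,2)]
  have "snd Y = 0"
    using assms(2) by (simp add: half_space_boundary_def)
  moreover have "k \<in> {0, 1, 2, 3}"
    using assms(3) by auto
  ultimately show ?thesis
    by (elim insertE emptyE)
      (simp_all add: bdry_op_simps lin_dist_pow_derivs[OF in_S(1)] lin_dist_pow_derivs[OF in_S(2)]
          dist_pow_reflect[OF assms(2)] lin_dist_pow_def)
qed

subsection \<open>Green functions\<close>

definition green_const :: "nat \<Rightarrow> real"
  where "green_const n = 1 / (2 * (real n - 1) * (real n - 3) * sphere_area n)"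

text \<open>The exponent is halved because \<open>dist_pow\<close> uses the squared distance. At
  \<open>X = Y\<close> both sides are 0, by the convention for \<open>0 powr e\<close>.\<close>

lemma norm_powr_eq_dist_pow: "norm (X - Y) powr e = dist_pow X (e / 2) Y"
proof -
  have "dist_pow X (e / 2) Y = (norm (X - Y) powr 2) powr (e / 2)"
    by (simp add: dist_pow_def dot_square_norm norm_minus_commute powr_numeral)
  also have "\<dots> = norm (X - Y) powr (2 * (e / 2))"
    by (rule powr_powr)
  finally show ?thesis by simp
qed

lemma fund_sol_eq_norm:
  "fund_sol (Z :: 'n::finite pt) = green_const CARD('n) * norm Z powr (3 - real CARD('n))"
  by (simp only: fund_sol_def green_const_def Let_def)

lemma fund_sol_eq:
  "fund_sol (X - Y) = lin_dist_pow (green_const CARD('n)) 0 X ((3 - real CARD('n)) / 2) (Y :: 'n::finite pt)"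
  by (simp add: fund_sol_eq_norm norm_powr_eq_dist_pow lin_dist_pow_def)

lemma reflect_notin_closed: "X \<in> half_space \<Longrightarrow> reflect X \<notin> closed_half_space"
  by (simp add: half_space_def closed_half_space_def)

lemma reflect_neq:
  assumes "X \<in> closed_half_space" "Y \<in> closed_half_space" "X \<noteq> Y"
  shows "reflect X \<noteq> Y"
  using assms by (auto simp: closed_half_space_def reflect_def prod_eq_iff)

lemma norm_reflect_diff: "(norm (reflect X - Y))\<^sup>2 = (norm (X - Y))\<^sup>2 + 4 * (snd X * snd Y)"
  unfolding power2_norm_eq_inner inner_prod_def by (simp add: algebra_simps)

text \<open>The function $s\,r^{1-n}$: the pole \<open>reflect X\<close> has last coordinate \<open>-t\<close>, so the linear
  factor is $-t + (s + t)$.\<close>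

definition normal_corr :: "'n::finite pt \<Rightarrow> 'n pt \<Rightarrow> real"
  where "normal_corr X = lin_dist_pow (- snd X) 1 (reflect X) ((1 - real CARD('n)) / 2)"

text \<open>In the formula for the iterated Laplacian, the first exponent annihilates n - 3 + 2p, a
  factor of the \<alpha> term. The second annihilates n - 1 + 2p, which occurs in both
  terms.\<close>

lemma biharmonic_lin_dist_pow:
  fixes Z :: "'n::finite pt"
  assumes "Y \<in> closed_half_space - {Z}"
    and "p = (3 - real CARD('n)) / 2 \<and> \<beta> = 0 \<or> p = (1 - real CARD('n)) / 2"
  shows "laplace (laplace (lin_dist_pow \<alpha> \<beta> Z p)) Y = 0"
  using assms(2)
proof
  assume "p = (1 - real CARD('n)) / 2"
  then have "real CARD('n) = 1 - 2 * p" by simp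
  then show ?thesis
    by (simp add: laplace_laplace_lin_dist_pow[OF assms(1)] lin_dist_pow_def)
qed (simp add: laplace_laplace_lin_dist_pow[OF assms(1)] lin_dist_pow_def)

text \<open>Orders 1 and 2 are those where reflection fails: for the pairs (0,1) and (2,3), the sign
  of the reflected term that fits order 0 or 3 gives the wrong sign at order 1 or 2.\<close>

lemma bdry_op_fund_sol:
  fixes X :: "'n::finite pt"
  assumes "X \<in> half_space" "Y \<in> half_space_boundary"
  defines "p \<equiv> (3 - real CARD('n)) / 2"
  shows "bdry_op (Suc 0) (lin_dist_pow c 0 X p) Y = 2 * p * c * snd X * dist_pow X (p - 1) Y"
    and "bdry_op 2 (lin_dist_pow c 0 X p) Y = 8 * p * (p - 1) * c * (snd X)\<^sup>2 * dist_pow X (p - 2) Y"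
proof -
  note S = boundary_in_punctured(1)[OF assms(1,2)]
  have Y: "snd Y = 0"
    using assms(2) by (simp add: half_space_boundary_def)
  have n: "real CARD('n) = 3 - 2 * p"
    by (simp add: p_def field_simps)
  show "bdry_op (Suc 0) (lin_dist_pow c 0 X p) Y = 2 * p * c * snd X * dist_pow X (p - 1) Y"
    by (simp add: bdry_op_simps lin_dist_pow_derivs[OF S] Y)
  show "bdry_op 2 (lin_dist_pow c 0 X p) Y = 8 * p * (p - 1) * c * (snd X)\<^sup>2 * dist_pow X (p - 2) Y"
    by (simp add: bdry_op_simps lin_dist_pow_derivs[OF S] Y n algebra_simps)
qed

text \<open>The correction leaves orders 0 and 3 untouched: at order 0 because s = 0 on the
  boundary, at order 3 because the two summands of the operator cancel. It can thus repair orders 1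
  and 2 separately.\<close>

lemma bdry_op_normal_corr:
  fixes X :: "'n::finite pt"
  assumes "X \<in> half_space" "Y \<in> half_space_boundary"
  defines "p \<equiv> (3 - real CARD('n)) / 2"
  shows "bdry_op 0 (normal_corr X) Y = 0"
    and "bdry_op (Suc 0) (normal_corr X) Y = - dist_pow X (p - 1) Y"
    and "bdry_op 2 (normal_corr X) Y = 4 * (p - 1) * snd X * dist_pow X (p - 2) Y"
    and "bdry_op 3 (normal_corr X) Y = 0"
proof -
  note S = boundary_in_punctured(2)[OF assms(1,2)]
  have Y: "snd Y = 0"
    using assms(2) by (simp add: half_space_boundary_def)
  have n: "real CARD('n) = 3 - 2 * p"
    by (simp add: p_def field_simps)
  have h: "normal_corr X = lin_dist_pow (- snd X) 1 (reflect X) (p - 1)"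
    by (simp add: normal_corr_def p_def field_simps)
  note d = lin_dist_pow_derivs[OF S] dist_pow_reflect[OF assms(2)] Y n
  show "bdry_op 0 (normal_corr X) Y = 0"
    by (simp add: bdry_op_simps h lin_dist_pow_def Y)
  show "bdry_op (Suc 0) (normal_corr X) Y = - dist_pow X (p - 1) Y"
    by (simp add: bdry_op_simps h d)
  show "bdry_op 2 (normal_corr X) Y = 4 * (p - 1) * snd X * dist_pow X (p - 2) Y"
    by (simp add: bdry_op_simps h d algebra_simps)
  show "bdry_op 3 (normal_corr X) Y = 0"
    by (simp add: bdry_op_simps h d algebra_simps power2_eq_square)
qed

text \<open>Ansatz for the regular part: a reflected fundamental solution plus a multiple, constant
  in \<open>Y\<close>, of the correction. Its pole lies outside the closed half-space, so it is
  smooth up to the boundary, and only the boundary identities remain to be checked.\<close>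

lemma biharmonic_greenI:
  fixes G :: "'n::finite pt \<Rightarrow> 'n pt \<Rightarrow> real"
  defines "\<Gamma> \<equiv> \<lambda>X. lin_dist_pow (green_const CARD('n)) 0 X ((3 - real CARD('n)) / 2) :: 'n pt \<Rightarrow> real"
  assumes "i < j" "j \<le> 3" "i + j \<noteq> 3"
    and G: "\<And>X Y. X \<in> closed_half_space \<Longrightarrow> Y \<in> closed_half_space \<Longrightarrow> X \<noteq> Y \<Longrightarrow>
      G X Y = fund_sol (X - Y) + (\<kappa> * fund_sol (reflect X - Y) + \<mu> X * normal_corr X Y)"
    and bdry: "\<And>X Y k. X \<in> half_space \<Longrightarrow> Y \<in> half_space_boundary \<Longrightarrow> k \<in> {i, j} \<Longrightarrow>
      \<kappa> * ((-1) ^ k * bdry_op k (\<Gamma> X) Y) + \<mu> X * bdry_op k (normal_corr X) Y = - bdry_op k (\<Gamma> X) Y"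
  shows "biharmonic_green i j G"
proof -
  define H where "H X Y = \<kappa> * \<Gamma> (reflect X) Y + \<mu> X * normal_corr X Y" for X Y
  have "G X Y = fund_sol (X - Y) + H X Y"
    if "X \<in> closed_half_space" "Y \<in> closed_half_space" "X \<noteq> Y" for X Y
    using G[OF that] by (simp add: H_def \<Gamma>_def fund_sol_eq)
  moreover have "Ck_on 4 half_space (H X) \<and> Ck_on j closed_half_space (H X) \<and>
      (\<forall>Y\<in>half_space. laplace (laplace (H X)) Y = 0) \<and>
      (\<forall>Y\<in>half_space_boundary.
         bdry_op i (H X) Y = - bdry_op i (\<lambda>Z. fund_sol (X - Z)) Y \<and>
         bdry_op j (H X) Y = - bdry_op j (\<lambda>Z. fund_sol (X - Z)) Y)"
    if X: "X \<in> half_space" for X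
  proof -
    note S = rel_open_closed_half_space
    note Z = reflect_notin_closed[OF X]
    have C\<Gamma>: "Ck_on k closed_half_space (\<Gamma> (reflect X))" and Ch: "Ck_on k closed_half_space (normal_corr X)" for k
      unfolding \<Gamma>_def normal_corr_def by (rule Ck_on_lin_dist_pow[OF S Z])+
    have CH: "Ck_on k closed_half_space (H X)" for k
      unfolding H_def[abs_def] by (intro Ck_on_add Ck_on_mult Ck_on_const S C\<Gamma> Ch)
    have sub: "half_space \<subseteq> closed_half_space"
      by (auto simp: half_space_def closed_half_space_def)
    have "laplace (laplace (H X)) Y = 0" if Y: "Y \<in> closed_half_space" for Y
    proof -
      have "laplace (laplace (H X)) Y =
          laplace (\<lambda>Y. \<kappa> * laplace (\<Gamma> (reflect X)) Y + \<mu> X * laplace (normal_corr X) Y) Y"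
        unfolding H_def[abs_def] by (rule laplace_cong[OF S Y]) (rule laplace_lin[OF S C\<Gamma> Ch])
      also have "\<dots> = \<kappa> * laplace (laplace (\<Gamma> (reflect X))) Y + \<mu> X * laplace (laplace (normal_corr X)) Y"
        by (rule laplace_lin[OF S Ck_on_laplace[OF S C\<Gamma>] Ck_on_laplace[OF S Ch] Y])
      also have "laplace (laplace (\<Gamma> (reflect X))) Y = 0"
        unfolding \<Gamma>_def by (rule biharmonic_lin_dist_pow) (use Y Z in auto)
      also have "laplace (laplace (normal_corr X)) Y = 0"
        unfolding normal_corr_def by (rule biharmonic_lin_dist_pow) (use Y Z in auto)
      finally show ?thesis by simp
    qed
    moreover have "bdry_op k (H X) Y = - bdry_op k (\<lambda>Z. fund_sol (X - Z)) Y"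
      if Y: "Y \<in> half_space_boundary" and k: "k \<in> {i, j}" for Y k
    proof -
      have k3: "k \<le> 3"
        using k assms(2,3) by auto
      have Yc: "Y \<in> closed_half_space"
        using boundary_in_punctured(1)[OF X Y] by blast
      have "bdry_op k (H X) Y = \<kappa> * bdry_op k (\<Gamma> (reflect X)) Y + \<mu> X * bdry_op k (normal_corr X) Y"
        unfolding H_def[abs_def] by (rule bdry_op_lin[OF S C\<Gamma> Ch Yc k3])
      also have "bdry_op k (\<Gamma> (reflect X)) Y = (-1) ^ k * bdry_op k (\<Gamma> X) Y"
        unfolding \<Gamma>_def by (rule bdry_op_reflect[OF X Y k3])
      also note bdry[OF X Y k]
      finally show ?thesis
        by (simp add: fund_sol_eq \<Gamma>_def)
    qed
    ultimately show ?thesis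
      using CH Ck_on_mono[OF CH sub] sub by blast
  qed
  ultimately show ?thesis
    unfolding biharmonic_green_def using assms(2-4) by blast
qed

text \<open>Since |X - Y|^2 = r^2 - 4ts, the bracket equals -2 - 4(n-3)ts/r^2; this puts the
  formulas of \<open>green01\<close> and \<open>green23\<close> into the shape of the
  ansatz.\<close>

lemma green_bracket:
  fixes X Y :: "'n::finite pt"
  assumes "reflect X \<noteq> Y"
  shows "1/2 * fund_sol (reflect X - Y) *
      ((real CARD('n) - 3) * ((norm (X - Y))\<^sup>2 / (norm (reflect X - Y))\<^sup>2) - (real CARD('n) - 1)) =
    - fund_sol (reflect X - Y)
    - 2 * green_const CARD('n) * (real CARD('n) - 3) * snd X * normal_corr X Y"
proof -
  define p where "p = (3 - real CARD('n)) / 2"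
  define d where "d = (norm (reflect X - Y))\<^sup>2"
  have d: "d \<noteq> 0"
    using assms by (simp add: d_def)
  have n: "real CARD('n) = 3 - 2 * p"
    by (simp add: p_def field_simps)
  have "d = (Y - reflect X) \<bullet> (Y - reflect X)"
    by (simp add: d_def norm_minus_commute power2_norm_eq_inner flip: power2_norm_eq_inner)
  \<comment> \<open>Splitting off r^2 expresses everything through r^(1-n), so that the denominator
    in the bracket cancels.\<close>
  then have "dist_pow (reflect X) p Y = d * dist_pow (reflect X) (p - 1) Y"
    using inner_mult_dist_pow[of Y "reflect X" "p - 1"] assms by simp
  then have f: "fund_sol (reflect X - Y) = green_const CARD('n) * d * dist_pow (reflect X) (p - 1) Y"
    by (simp add: fund_sol_eq lin_dist_pow_def p_def)
  have h: "normal_corr X Y = snd Y * dist_pow (reflect X) (p - 1) Y"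
    by (simp add: normal_corr_def lin_dist_pow_def p_def field_simps)
  have e: "(norm (X - Y))\<^sup>2 = d - 4 * (snd X * snd Y)"
    by (simp add: d_def norm_reflect_diff)
  show ?thesis
    unfolding f h e d_def[symmetric] n using d by (simp add: field_simps)
qed

text \<open>Both orders are even, so subtracting the reflection cancels both data; for (1,3) both
  are odd and the reflection is added.\<close>

lemma biharmonic_green02: "biharmonic_green 0 2 (green02 :: 'n::finite pt \<Rightarrow> 'n pt \<Rightarrow> real)"
  by (rule biharmonic_greenI[where \<kappa> = "-1" and \<mu> = "\<lambda>X. 0"]) (auto simp: green02_def)

lemma biharmonic_green13: "biharmonic_green 1 3 (green13 :: 'n::finite pt \<Rightarrow> 'n pt \<Rightarrow> real)"
  by (rule biharmonic_greenI[where \<kappa> = 1 and \<mu> = "\<lambda>X. 0"]) (auto simp: green13_def)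

text \<open>The sign -1 settles order 0. At order 1 the correction must contribute minus twice the
  datum of the fundamental solution, which forces this \<mu>.\<close>

lemma biharmonic_green01: "biharmonic_green 0 1 (green01 :: 'n::finite pt \<Rightarrow> 'n pt \<Rightarrow> real)"
proof (rule biharmonic_greenI[where \<kappa> = "-1" and
      \<mu> = "\<lambda>X. - 2 * green_const CARD('n) * (real CARD('n) - 3) * snd X"])
  show "green01 X Y = fund_sol (X - Y) + (- 1 * fund_sol (reflect X - Y) +
      - 2 * green_const CARD('n) * (real CARD('n) - 3) * snd X * normal_corr X Y)"
    if "X \<in> closed_half_space" "Y \<in> closed_half_space" "X \<noteq> Y" for X Y :: "'n pt"
    unfolding green01_def Let_def green_bracket[OF reflect_neq[OF that]] by simp
qed (auto simp: bdry_op_fund_sol bdry_op_normal_corr field_simps)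

text \<open>The sign +1 settles order 3, and cancelling twice the datum at order 2 gives the
  negative of the \<mu> for (0,1).\<close>

lemma biharmonic_green23: "biharmonic_green 2 3 (green23 :: 'n::finite pt \<Rightarrow> 'n pt \<Rightarrow> real)"
proof (rule biharmonic_greenI[where \<kappa> = 1 and
      \<mu> = "\<lambda>X. 2 * green_const CARD('n) * (real CARD('n) - 3) * snd X"])
  show "green23 X Y = fund_sol (X - Y) + (1 * fund_sol (reflect X - Y) +
      2 * green_const CARD('n) * (real CARD('n) - 3) * snd X * normal_corr X Y)"
    if "X \<in> closed_half_space" "Y \<in> closed_half_space" "X \<noteq> Y" for X Y :: "'n pt"
    unfolding green23_def Let_def green_bracket[OF reflect_neq[OF that]] by simp
qed (auto simp: bdry_op_fund_sol bdry_op_normal_corr field_simps power2_eq_square)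

subsection \<open>Comparison of the Green functions\<close>

lemma green_profile_pos:
  fixes a q :: real
  assumes "a > 0 \<or> a = - 1/2" \<comment> \<open>\<open>a = (n - 3)/2\<close> with \<open>n > 3\<close> or \<open>n = 2\<close>\<close>
    and "0 < q" "q < 1"
  shows "a * (q powr - a + a * q - (a + 1)) > 0"
  using assms(1)
proof
  assume a: "a > 0"
  \<comment> \<open>This supplies the strictness; exp x >= 1 + x at x = -a ln q then bounds q^(-a)
    from below.\<close>
  have "ln q < q - 1"
    using ln_le_minus_one[of q] ln_eq_minus_one[of q] assms by fastforce
  then have "a * (1 - q) < a * - ln q"
    using a by (intro mult_strict_left_mono) auto
  also have "\<dots> \<le> q powr - a - 1"
    using exp_ge_add_one_self[of "a * - ln q"] assms(2) by (simp add: powr_def)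
  finally show ?thesis
    using a by (intro mult_pos_pos) (auto simp: algebra_simps)
next
  assume a: "a = - 1/2"
  \<comment> \<open>For a = -1/2 the whole expression is (sqrt q - 1)^2 / 4.\<close>
  have "sqrt q \<noteq> 1"
    using assms by simp
  then have "(sqrt q - 1)\<^sup>2 > 0" by simp
  then show ?thesis
    using assms(2) by (simp add: a powr_half_sqrt power2_eq_square algebra_simps)
qed

text \<open>All four functions become \<kappa> P times a function of q, and the boundary case is q =
  1. The middle gap is twice the reflected fundamental solution: it never vanishes and has the sign
  of n - 3, hence its separate treatment.\<close>

lemma green_inequalities:
  fixes X Y :: "'n::finite pt"
  assumes n: "CARD('n) \<ge> 2" "CARD('n) \<noteq> 3"
    and XY: "X \<in> closed_half_space" "Y \<in> closed_half_space" "X \<noteq> Y"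
  defines "bd \<equiv> X \<in> half_space_boundary \<or> Y \<in> half_space_boundary"
  shows "if bd then green01 X Y = 0 else green01 X Y > 0"
    and "if bd then green01 X Y = green02 X Y else green01 X Y < green02 X Y"
    and "if bd then green13 X Y = green23 X Y else green13 X Y < green23 X Y"
    and "green02 X Y \<noteq> green13 X Y"
    and "CARD('n) \<noteq> 2 \<Longrightarrow> green02 X Y \<le> green13 X Y"
proof -
  define a where "a = (real CARD('n) - 3) / 2"
  \<comment> \<open>Division by \<open>a\<close> absorbs the sign of the constant, so \<kappa> is
    positive for n = 2 as well as for n > 3.\<close>
  define \<kappa> where "\<kappa> = green_const CARD('n) / a"
  define r where "r = norm (reflect X - Y)"
  define P where "P = r powr (- 2 * a)"
  define q where "q = (norm (X - Y))\<^sup>2 / r\<^sup>2"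
  have a: "a > 0 \<or> a = - 1/2"
  proof (cases "CARD('n) = 2")
    case False
    then have "CARD('n) > 3" using n by simp
    then show ?thesis by (simp add: a_def)
  qed (simp add: a_def)
  have nn: "real CARD('n) = 2 * a + 3"
    by (simp add: a_def field_simps)
  then have nn': "real CARD('n) - 3 = 2 * a" "real CARD('n) - 1 = 2 * a + 2"
    by simp_all
  have "sphere_area CARD('n) > 0"
    unfolding sphere_area_def by (intro mult_pos_pos unit_ball_vol_pos) auto
  moreover have "\<kappa> = 1 / (4 * (real CARD('n) - 1) * a\<^sup>2 * sphere_area CARD('n))"
    by (simp add: \<kappa>_def green_const_def nn power2_eq_square)
  moreover have "real CARD('n) - 1 > 0" "a\<^sup>2 > 0"
    using n(1) a by auto
  ultimately have \<kappa>: "\<kappa> > 0"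
    by (simp only: zero_less_divide_1_iff) (intro mult_pos_pos, auto)
  have r: "r > 0"
    using reflect_neq[OF XY] by (simp add: r_def)
  then have P: "P > 0" by (simp add: P_def)
  have q0: "q > 0"
    using XY(3) r by (simp add: q_def)
  have q1: "1 - q = 4 * (snd X * snd Y) / r\<^sup>2"
  proof -
    have "1 - q = (r\<^sup>2 - (norm (X - Y))\<^sup>2) / r\<^sup>2"
      using r by (simp add: q_def diff_divide_distrib)
    then show ?thesis
      by (simp add: r_def norm_reflect_diff)
  qed
  have bd: "q = 1 \<longleftrightarrow> bd"
    using r q1 by (auto simp: bd_def half_space_boundary_def)
  have "snd X * snd Y \<ge> 0"
    using XY by (simp add: closed_half_space_def)
  then have "q \<le> 1"
    using q1 r by (smt (verit) divide_nonneg_nonneg zero_le_power2)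
  then have q: "\<not> bd \<Longrightarrow> q < 1"
    using bd by linarith
  have gc: "green_const CARD('n) = \<kappa> * a"
    using a by (auto simp: \<kappa>_def)
  have fr: "fund_sol (reflect X - Y) = \<kappa> * a * P"
    by (simp add: fund_sol_eq_norm gc P_def r_def nn)
  have "norm (X - Y) powr (- 2 * a) = P * q powr - a"
  proof -
    have "norm (X - Y) = r * sqrt q"
      using r by (simp add: q_def real_sqrt_divide)
    then show ?thesis
      using q0 r by (simp add: P_def powr_mult powr_half_sqrt[symmetric] powr_powr)
  qed
  then have fX: "fund_sol (X - Y) = \<kappa> * a * P * q powr - a"
    by (simp add: fund_sol_eq_norm gc nn)
  have g01: "green01 X Y = \<kappa> * P * (a * (q powr - a + a * q - (a + 1)))"
    unfolding green01_def Let_def nn' r_def[symmetric] q_def[symmetric]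
    by (simp add: fr fX algebra_simps)
  \<comment> \<open>The first and the last gap of the chain are the same quantity; it contains
    \<open>a\<close> squared, so its sign does not depend on n.\<close>
  have g02: "green02 X Y = green01 X Y + \<kappa> * P * a\<^sup>2 * (1 - q)"
    by (simp add: g01 green02_def fr fX power2_eq_square algebra_simps)
  have g13: "green13 X Y = green02 X Y + 2 * \<kappa> * P * a"
    by (simp add: green02_def green13_def fr)
  have g23: "green23 X Y = green13 X Y + \<kappa> * P * a\<^sup>2 * (1 - q)"
    unfolding green23_def Let_def nn' r_def[symmetric] q_def[symmetric]
    by (simp add: green13_def fr fX power2_eq_square algebra_simps)
  have incr: "\<kappa> * P * a\<^sup>2 * (1 - q) > 0" if "\<not> bd"
    using \<kappa> P a q[OF that] by auto
  show "if bd then green01 X Y = 0 else green01 X Y > 0"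
    using bd \<kappa> P q q0 green_profile_pos[OF a q0] by (auto simp: g01)
  show "if bd then green01 X Y = green02 X Y else green01 X Y < green02 X Y"
    using bd incr by (auto simp: g02)
  show "if bd then green13 X Y = green23 X Y else green13 X Y < green23 X Y"
    using bd incr by (auto simp: g23)
  show "green02 X Y \<noteq> green13 X Y"
    using \<kappa> P a by (auto simp: g13)
  show "green02 X Y \<le> green13 X Y" if "CARD('n) \<noteq> 2"
    using \<kappa> P a that by (auto simp: g13 a_def)
qed

theorem theorem1p2:
  assumes "CARD('n::finite) \<ge> 2" and "CARD('n) \<noteq> 3"
  shows "biharmonic_green 0 2 (green02 :: 'n pt \<Rightarrow> 'n pt \<Rightarrow> real) \<and>
    biharmonic_green 1 3 (green13 :: 'n pt \<Rightarrow> 'n pt \<Rightarrow> real) \<and>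
    biharmonic_green 0 1 (green01 :: 'n pt \<Rightarrow> 'n pt \<Rightarrow> real) \<and>
    biharmonic_green 2 3 (green23 :: 'n pt \<Rightarrow> 'n pt \<Rightarrow> real) \<and>
    (\<forall>X\<in>closed_half_space. \<forall>Y\<in>closed_half_space :: 'n pt set. X \<noteq> Y \<longrightarrow>
       0 \<le> green01 X Y \<and>
       green01 X Y \<le> green02 X Y \<and>
       (CARD('n) \<noteq> 2 \<longrightarrow> green02 X Y \<le> green13 X Y) \<and>
       green13 X Y \<le> green23 X Y \<and>
       (0 = green01 X Y \<longleftrightarrow> X \<in> half_space_boundary \<or> Y \<in> half_space_boundary) \<and>
       (green01 X Y = green02 X Y \<longleftrightarrow> X \<in> half_space_boundary \<or> Y \<in> half_space_boundary) \<and>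
       green02 X Y \<noteq> green13 X Y \<and>
       (green13 X Y = green23 X Y \<longleftrightarrow> X \<in> half_space_boundary \<or> Y \<in> half_space_boundary))"
proof (intro conjI biharmonic_green01 biharmonic_green02 biharmonic_green13 biharmonic_green23 ballI impI)
qed (use green_inequalities[OF assms] in \<open>smt (verit)\<close>)+

end
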